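(* Let $P\subseteq\mathbb{R}^3$ be the convex hull of $\{(0,0,1),(1,0,2),(0,2,1),(2,2,1),(1,1,0)\}$. If $Q\subseteq\mathbb{R}^3$ is a lattice polytope containing the image of $P$ under an element of $GL(3,\mathbb{Z})$ followed by a lattice translation, then $M(X_Q^{\{2\}})\neq 2M(X_Q)$.
   Context: Work over $\mathbb{C}$. For a lattice polytope $Q$ with lattice points $m_1,\ldots,m_N$, the toric variety $X_Q$ is the Zariski closure of the image of the torus under $t\mapsto(t^{m_1},\ldots,t^{m_N})$, viewed as an affine cone in $\mathbb{A}^N$ (cone over the projective toric variety in $\mathbb{P}^{N-1}$), with coordinate $z_j$ corresponding to $m_j$. The secant variety is $X^{\{2\}}=\overline{\{x_1+x_2:x_i\in X\}}$. The algebraic matroid $M(Y)$ of an irreducible $Y\subseteq\mathbb{A}^N$ is the matroid on $\{z_1,\ldots,z_N\}$ in which $E$ is independent iff $\mathcal{I}(Y)\cap\mathbb{C}[E]=\langle0\rangle$. $2M=M\vee M$ is the matroid union, whose independent sets are unions of two independent sets of $M$. *)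

theory Defs
  imports "HOL-Analysis.Analysis" "HOL-Library.Poly_Mapping"
begin

text \<open>
  Polynomials are finitely supported maps from monomials to coefficients; a monomial is a
  finitely supported map from variables to exponents.
\<close>

type_synonym 'i cpoly = "('i \<Rightarrow>\<^sub>0 nat) \<Rightarrow>\<^sub>0 complex"

definition poly_vars :: "'i cpoly \<Rightarrow> 'i set" where
  "poly_vars p = (\<Union>u \<in> Poly_Mapping.keys p. Poly_Mapping.keys u)"

definition poly_ring :: "'i set \<Rightarrow> 'i cpoly set" where
  "poly_ring E = {p. poly_vars p \<subseteq> E}"

definition poly_eval :: "'i cpoly \<Rightarrow> ('i \<Rightarrow> complex) \<Rightarrow> complex" where
  "poly_eval p x =
     (\<Sum>u \<in> Poly_Mapping.keys p.
        Poly_Mapping.lookup p u *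
        (\<Prod>i \<in> Poly_Mapping.keys u. x i ^ Poly_Mapping.lookup u i))"

text \<open>
  Affine space with coordinates indexed by a set I.  Since I is a set and not a type, its points
  are functions on the whole index type, normalised to vanish outside I, so that the pointwise
  operations do not leave the space.
\<close>

definition affine_space :: "'i set \<Rightarrow> ('i \<Rightarrow> complex) set" where
  "affine_space I = {x. \<forall>i. i \<notin> I \<longrightarrow> x i = 0}"

definition vanishing_ideal :: "'i set \<Rightarrow> ('i \<Rightarrow> complex) set \<Rightarrow> 'i cpoly set" where
  "vanishing_ideal I Y = {p \<in> poly_ring I. \<forall>y\<in>Y. poly_eval p y = 0}"

definition zero_locus :: "'i set \<Rightarrow> 'i cpoly set \<Rightarrow> ('i \<Rightarrow> complex) set" where
  "zero_locus I F = {x \<in> affine_space I. \<forall>p\<in>F. poly_eval p x = 0}"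

definition zariski_closure :: "'i set \<Rightarrow> ('i \<Rightarrow> complex) set \<Rightarrow> ('i \<Rightarrow> complex) set" where
  "zariski_closure I Y = zero_locus I (vanishing_ideal I Y)"

definition secant_variety :: "'i set \<Rightarrow> ('i \<Rightarrow> complex) set \<Rightarrow> ('i \<Rightarrow> complex) set" where
  "secant_variety I X =
     zariski_closure I {(\<lambda>i. x1 i + x2 i) | x1 x2. x1 \<in> X \<and> x2 \<in> X}"

text \<open>
  A matroid is given by its ground set and its family of independent sets, so equality of matroids
  is equality of such pairs.
\<close>

type_synonym 'i matroid = "'i set \<times> 'i set set"

definition ground_set :: "'i matroid \<Rightarrow> 'i set" where
  "ground_set M = fst M"

definition indep_sets :: "'i matroid \<Rightarrow> 'i set set" where
  "indep_sets M = snd M"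

definition algebraic_matroid :: "'i set \<Rightarrow> ('i \<Rightarrow> complex) set \<Rightarrow> 'i matroid" where
  "algebraic_matroid I Y =
     (I, {E. E \<subseteq> I \<and> vanishing_ideal I Y \<inter> poly_ring E = {0}})"

definition matroid_union :: "'i matroid \<Rightarrow> 'i matroid \<Rightarrow> 'i matroid" where
  "matroid_union M M' =
     (ground_set M \<union> ground_set M', {A \<union> B | A B. A \<in> indep_sets M \<and> B \<in> indep_sets M'})"

definition of_lattice :: "int ^ 'n \<Rightarrow> real ^ 'n" where
  "of_lattice m = (\<chi> i. real_of_int (m $ i))"

definition lattice_polytope :: "(real ^ 'n) set \<Rightarrow> bool" where
  "lattice_polytope Q \<longleftrightarrow> (\<exists>V. finite V \<and> Q = convex hull (of_lattice ` V))"

definition lattice_points :: "(real ^ 'n) set \<Rightarrow> (int ^ 'n) set" where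
  "lattice_points Q = {m. of_lattice m \<in> Q}"

definition torus :: "(complex ^ 'n) set" where
  "torus = {t. \<forall>i. t $ i \<noteq> 0}"

definition torus_character :: "int ^ 'n \<Rightarrow> complex ^ 'n \<Rightarrow> complex" where
  "torus_character m t = (\<Prod>i\<in>UNIV. (t $ i) powi (m $ i))"

text \<open>The coordinates of the ambient space are indexed by the lattice points of Q themselves.\<close>

definition monomial_map :: "(real ^ 'n) set \<Rightarrow> complex ^ 'n \<Rightarrow> (int ^ 'n \<Rightarrow> complex)" where
  "monomial_map Q t = (\<lambda>m. if m \<in> lattice_points Q then torus_character m t else 0)"

text \<open>
  The affine cone over the projective toric variety: the scalar c is needed because the image of
  the torus is in general not closed under scaling.
\<close>

definition toric_variety :: "(real ^ 'n) set \<Rightarrow> (int ^ 'n \<Rightarrow> complex) set" where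
  "toric_variety Q =
     zariski_closure (lattice_points Q) {(\<lambda>m. c * monomial_map Q t m) | c t. t \<in> torus}"

definition lattice_affine_image ::
    "int ^ 'n ^ 'n \<Rightarrow> int ^ 'n \<Rightarrow> (real ^ 'n) set \<Rightarrow> (real ^ 'n) set" where
  "lattice_affine_image A b S =
     (\<lambda>x. map_matrix real_of_int A *v x + of_lattice b) ` S"

end

theory Submission
  imports Defs
begin

text \<open>
  The slice of \<open>P\<close> at height \<open>1\<close> is a unimodular copy of twice the standard triangle, so the six
  coordinates of its lattice points form a symmetric \<open>3 \<times> 3\<close> matrix (the quadratic Veronese
  surface).  This matrix has rank at most one on \<open>X\<^sub>Q\<close>, hence rank at most two on the secant
  variety, and its determinant shows that the six points are dependent in the matroid of the secant
  variety.  On the other hand they split into two affinely independent triples (the vertices and the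
  midpoints of the edges), and affinely independent points are independent in \<open>M(X\<^sub>Q)\<close>.
\<close>

section \<open>Polynomials\<close>

lemma poly_eval_eq_sum:
  assumes "finite S" "Poly_Mapping.keys p \<subseteq> S"
  shows "poly_eval p x = (\<Sum>u\<in>S. Poly_Mapping.lookup p u *
           (\<Prod>i \<in> Poly_Mapping.keys u. x i ^ Poly_Mapping.lookup u i))"
  unfolding poly_eval_def
  by (rule sum.mono_neutral_left) (use assms in \<open>auto simp: in_keys_iff\<close>)

lemma poly_eval_zero [simp]: "poly_eval 0 x = 0"
  by (simp add: poly_eval_def)

lemma poly_eval_add [simp]: "poly_eval (p + q) x = poly_eval p x + poly_eval q x"
proof -
  let ?S = "Poly_Mapping.keys p \<union> Poly_Mapping.keys q"
  have keys: "Poly_Mapping.keys (p + q) \<subseteq> ?S"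
    by (rule Poly_Mapping.keys_add)
  have eval: "poly_eval r x = (\<Sum>u\<in>?S. Poly_Mapping.lookup r u *
      (\<Prod>i \<in> Poly_Mapping.keys u. x i ^ Poly_Mapping.lookup u i))"
    if "Poly_Mapping.keys r \<subseteq> ?S" for r
    by (rule poly_eval_eq_sum[OF _ that]) simp
  show ?thesis
    unfolding eval[OF keys] eval[OF Un_upper1] eval[OF Un_upper2]
    by (simp only: lookup_add distrib_right sum.distrib)
qed

lemma poly_ring_add: "p \<in> poly_ring E \<Longrightarrow> q \<in> poly_ring E \<Longrightarrow> p + q \<in> poly_ring E"
  unfolding poly_ring_def poly_vars_def mem_Collect_eq UN_subset_iff
  using Poly_Mapping.keys_add[of p q] by blast

lemma poly_ring_mono: "E \<subseteq> F \<Longrightarrow> poly_ring E \<subseteq> poly_ring F"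
  by (auto simp: poly_ring_def)

text \<open>Variables are listed with repetition, so that a square is a repeated entry and
  evaluation becomes a product over the list.\<close>

definition monomial_of :: "complex \<Rightarrow> 'i list \<Rightarrow> 'i cpoly" where
  "monomial_of c xs = Poly_Mapping.single (\<Sum>i\<leftarrow>xs. Poly_Mapping.single i 1) c"

lemma keys_sum_list_single:
  "Poly_Mapping.keys (\<Sum>i\<leftarrow>xs. Poly_Mapping.single i (1::nat)) \<subseteq> set xs"
proof (induction xs)
  case (Cons a xs)
  then show ?case
    using Poly_Mapping.keys_add[of "Poly_Mapping.single a (1::nat)" "\<Sum>i\<leftarrow>xs. Poly_Mapping.single i 1"]
    by auto
qed simp

lemma poly_ring_monomial_of: "set xs \<subseteq> E \<Longrightarrow> monomial_of c xs \<in> poly_ring E"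
  using keys_sum_list_single[of xs]
  by (auto simp: monomial_of_def poly_ring_def poly_vars_def split: if_splits)

text \<open>The index set \<open>S\<close> stays fixed during the induction, whereas the support of
  the exponent map varies with the list; over a fixed \<open>S\<close> exponents simply add.\<close>

lemma prod_sum_list_single:
  fixes x :: "'i \<Rightarrow> complex"
  assumes "finite S" "set xs \<subseteq> S"
  shows "(\<Prod>i\<in>S. x i ^ Poly_Mapping.lookup (\<Sum>i\<leftarrow>xs. Poly_Mapping.single i 1) i) = (\<Prod>i\<leftarrow>xs. x i)"
  using assms(2)
proof (induction xs)
  case (Cons a xs)
  have "(\<Prod>i\<in>S. x i ^ Poly_Mapping.lookup (Poly_Mapping.single a 1) i) = (\<Prod>i\<in>S. if i = a then x i else 1)"
    by (rule prod.cong) (auto simp: lookup_single when_def)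
  also have "\<dots> = x a"
    using Cons.prems assms(1) by simp
  finally show ?case
    using Cons by (simp add: lookup_add power_add prod.distrib)
qed simp

lemma poly_eval_monomial_of [simp]: "poly_eval (monomial_of c xs) x = c * (\<Prod>i\<leftarrow>xs. x i)"
proof -
  let ?u = "\<Sum>i\<leftarrow>xs. Poly_Mapping.single i (1::nat)"
  have "(\<Prod>i\<in>Poly_Mapping.keys ?u. x i ^ Poly_Mapping.lookup ?u i)
      = (\<Prod>i\<in>set xs. x i ^ Poly_Mapping.lookup ?u i)"
    by (rule prod.mono_neutral_left) (use keys_sum_list_single[of xs] in \<open>auto simp: in_keys_iff\<close>)
  also have "\<dots> = (\<Prod>i\<leftarrow>xs. x i)"
    by (rule prod_sum_list_single) auto
  finally show ?thesis
    by (simp add: monomial_of_def poly_eval_def)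
qed

section \<open>Zariski closure and Kronecker substitution\<close>

lemma poly_eval_eq_0_on_zariski_closure:
  assumes "p \<in> poly_ring I" "\<And>y. y \<in> Y \<Longrightarrow> poly_eval p y = 0" "x \<in> zariski_closure I Y"
  shows "poly_eval p x = 0"
  using assms by (auto simp: zariski_closure_def zero_locus_def vanishing_ideal_def)

lemma subset_zariski_closure: "Y \<subseteq> affine_space I \<Longrightarrow> Y \<subseteq> zariski_closure I Y"
  by (auto simp: zariski_closure_def zero_locus_def vanishing_ideal_def)

text \<open>Expansion in base \<open>N\<close>: the weights are successive powers of
  \<open>N\<close>, and the values of \<open>f\<close> are the digits of the weighted sum.\<close>

lemma exists_weights_separating_bounded:
  fixes N :: nat
  assumes "finite E"
  shows "\<exists>d :: 'i \<Rightarrow> nat. \<forall>f g. (\<forall>i\<in>E. f i < N \<and> g i < N) \<longrightarrow>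
           (\<Sum>i\<in>E. f i * d i) = (\<Sum>i\<in>E. g i * d i) \<longrightarrow> (\<forall>i\<in>E. f i = g i)"
  using assms
proof (induction E)
  case (insert a E)
  then obtain d :: "'i \<Rightarrow> nat" where d: "\<And>f g. (\<forall>i\<in>E. f i < N \<and> g i < N) \<Longrightarrow>
      (\<Sum>i\<in>E. f i * d i) = (\<Sum>i\<in>E. g i * d i) \<Longrightarrow> (\<forall>i\<in>E. f i = g i)"
    by blast
  \<comment> \<open>The new element becomes the lowest digit and the old weights move up by one
    place.\<close>
  define d' where "d' = (\<lambda>i. if i = a then 1 else N * d i)"
  have sum_d': "(\<Sum>i\<in>insert a E. f i * d' i) = f a + N * (\<Sum>i\<in>E. f i * d i)" for f
  proof -
    have "(\<Sum>i\<in>E. f i * d' i) = (\<Sum>i\<in>E. N * (f i * d i))"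
      using insert.hyps by (intro sum.cong) (auto simp: d'_def)
    then show ?thesis
      using insert.hyps by (simp add: d'_def sum_distrib_left)
  qed
  show ?case
  proof (intro exI[of _ d'] allI impI)
    fix f g :: "'i \<Rightarrow> nat"
    assume bound: "\<forall>i\<in>insert a E. f i < N \<and> g i < N"
      and "(\<Sum>i\<in>insert a E. f i * d' i) = (\<Sum>i\<in>insert a E. g i * d' i)"
    then have eq: "f a + N * (\<Sum>i\<in>E. f i * d i) = g a + N * (\<Sum>i\<in>E. g i * d i)"
      unfolding sum_d' by simp
    \<comment> \<open>Reduction modulo \<open>N\<close> recovers the lowest digit; cancelling it and
      dividing by \<open>N\<close> leaves the equation for \<open>E\<close>.\<close>
    have "f a = g a"
      using arg_cong[OF eq, of "\<lambda>n. n mod N"] bound by simp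
    moreover have "\<forall>i\<in>E. f i = g i"
      using d[of f g] eq bound \<open>f a = g a\<close> by auto
    ultimately show "\<forall>i\<in>insert a E. f i = g i"
      by simp
  qed
qed simp

text \<open>
  Kronecker substitution.  The factor \<open>k\<close> is needed because a triple of lattice points may span a
  sublattice of index greater than one.
\<close>

lemma poly_eq_0_if_eval_on_curves_eq_0:
  fixes p :: "'i cpoly"
  assumes fin: "finite E" and p: "p \<in> poly_ring E"
    and curves: "\<And>d :: 'i \<Rightarrow> nat. \<exists>k>0. \<forall>s. s \<noteq> 0 \<longrightarrow>
                   (\<exists>x. (\<forall>i\<in>E. x i = s ^ (k * d i)) \<and> poly_eval p x = 0)"
  shows "p = 0"
proof -
  let ?K = "Poly_Mapping.keys p"
  have keys: "Poly_Mapping.keys u \<subseteq> E" if "u \<in> ?K" for u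
    using p that by (auto simp: poly_ring_def poly_vars_def)
  \<comment> \<open>A crude strict bound on every exponent that occurs in \<open>p\<close>.\<close>
  define N where "N = Suc (\<Sum>u\<in>?K. \<Sum>i\<in>E. Poly_Mapping.lookup u i)"
  have bound: "Poly_Mapping.lookup u i < N" if "u \<in> ?K" "i \<in> E" for u i
  proof -
    have "Poly_Mapping.lookup u i \<le> (\<Sum>i\<in>E. Poly_Mapping.lookup u i)"
      using fin that by (intro member_le_sum) auto
    also have "\<dots> \<le> (\<Sum>u\<in>?K. \<Sum>i\<in>E. Poly_Mapping.lookup u i)"
      using that by (intro member_le_sum) auto
    finally show ?thesis
      by (simp add: N_def)
  qed
  obtain d :: "'i \<Rightarrow> nat" where d: "\<And>f g. (\<forall>i\<in>E. f i < N \<and> g i < N) \<Longrightarrow>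
      (\<Sum>i\<in>E. f i * d i) = (\<Sum>i\<in>E. g i * d i) \<Longrightarrow> (\<forall>i\<in>E. f i = g i)"
    using exists_weights_separating_bounded[OF fin, of N] by blast
  \<comment> \<open>On the curve the monomial \<open>u\<close> becomes \<open>s ^ (k * D u)\<close>;
    the weights \<open>d\<close> make \<open>D\<close> injective on the support of
    \<open>p\<close>.\<close>
  define D where "D = (\<lambda>u :: 'i \<Rightarrow>\<^sub>0 nat. \<Sum>i\<in>E. Poly_Mapping.lookup u i * d i)"
  have inj: "u = v" if "u \<in> ?K" "v \<in> ?K" "D u = D v" for u v
  proof (rule poly_mapping_eqI)
    fix i
    show "Poly_Mapping.lookup u i = Poly_Mapping.lookup v i"
    proof (cases "i \<in> E")
      case True
      then show ?thesis
        using d[of "Poly_Mapping.lookup u" "Poly_Mapping.lookup v"] bound that by (simp add: D_def)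
    next
      case False
      then show ?thesis
        using keys[OF that(1)] keys[OF that(2)] by (metis in_keys_iff subsetD)
    qed
  qed
  obtain k where "k > 0" and k: "\<And>s. s \<noteq> 0 \<Longrightarrow>
      \<exists>x. (\<forall>i\<in>E. x i = s ^ (k * d i)) \<and> poly_eval p x = 0"
    using curves[of d] by blast
  \<comment> \<open>The restriction of \<open>p\<close> to the curve, as a univariate polynomial in
    \<open>s\<close>.\<close>
  define q where "q = (\<Sum>u\<in>?K. monom (Poly_Mapping.lookup p u) (k * D u))"
  have "poly q s = 0" if "s \<noteq> 0" for s
  proof -
    obtain x where x: "\<And>i. i \<in> E \<Longrightarrow> x i = s ^ (k * d i)" and 0: "poly_eval p x = 0"
      using k[of s] \<open>s \<noteq> 0\<close> by blast
    have "(\<Prod>i\<in>Poly_Mapping.keys u. x i ^ Poly_Mapping.lookup u i) = s ^ (k * D u)"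
      if "u \<in> ?K" for u
    proof -
      have "(\<Prod>i\<in>Poly_Mapping.keys u. x i ^ Poly_Mapping.lookup u i)
          = (\<Prod>i\<in>E. x i ^ Poly_Mapping.lookup u i)"
        by (rule prod.mono_neutral_left) (use fin keys[OF that] in \<open>auto simp: in_keys_iff\<close>)
      also have "\<dots> = (\<Prod>i\<in>E. s ^ (k * (Poly_Mapping.lookup u i * d i)))"
        by (rule prod.cong) (simp_all add: x power_mult [symmetric] ac_simps)
      also have "\<dots> = s ^ (k * D u)"
        by (simp add: D_def sum_distrib_left power_sum)
      finally show ?thesis .
    qed
    then have "poly_eval p x = poly q s"
      by (simp add: poly_eval_def q_def poly_sum poly_monom)
    with 0 show ?thesis by simp
  qed
  \<comment> \<open>Infinitely many roots remain after \<open>s = 0\<close> is excluded, so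
    \<open>q\<close> must vanish.\<close>
  then have "- {0} \<subseteq> {s. poly q s = 0}"
    by auto
  moreover have "infinite (- {0 :: complex})"
    using finite_compl[of "{0 :: complex}"] infinite_UNIV_char_0 by blast
  ultimately have "q = 0"
    using poly_roots_finite finite_subset by blast
  have "Poly_Mapping.lookup p u = 0" if u: "u \<in> ?K" for u
  proof -
    \<comment> \<open>No two monomials of \<open>p\<close> share a power of \<open>s\<close>, since
      \<open>D\<close> is injective on them and \<open>k > 0\<close>; each coefficient of
      \<open>p\<close> thus survives alone in \<open>q\<close>.\<close>
    have "coeff q (k * D u) = (\<Sum>v\<in>?K. if v = u then Poly_Mapping.lookup p v else 0)"
      unfolding q_def coeff_sum coeff_monom
      by (rule sum.cong) (use inj u \<open>k > 0\<close> in auto)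
    with u \<open>q = 0\<close> show ?thesis by simp
  qed
  then show ?thesis
    by (metis in_keys_iff keys_eq_empty ex_in_conv)
qed

section \<open>Toric varieties\<close>

lemma scaled_monomial_map_in_affine_space:
  "(\<lambda>m. c * monomial_map Q t m) \<in> affine_space (lattice_points Q)"
  by (simp add: affine_space_def monomial_map_def)

lemma torus_character_add:
  "t \<in> torus \<Longrightarrow> torus_character (m + m') t = torus_character m t * torus_character m' t"
  by (simp add: torus_character_def torus_def power_int_add prod.distrib)

text \<open>The restriction of a character to the one-parameter subgroup with exponents
  \<open>w\<close>; it produces monomial curves in the torus.\<close>

lemma torus_character_one_parameter:
  fixes w m :: "int ^ 'n"
  assumes "s \<noteq> 0"
  shows "torus_character m (\<chi> i. s powi (w $ i)) = s powi (\<Sum>i\<in>UNIV. w $ i * m $ i)"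
proof -
  have "(\<Prod>i\<in>S. s powi (w $ i * m $ i)) = s powi (\<Sum>i\<in>S. w $ i * m $ i)" if "finite S" for S
    using that by (induction S) (simp_all add: power_int_add assms)
  then show ?thesis
    by (simp add: torus_character_def power_int_mult)
qed

text \<open>Characters are multiplicative, and the binomial is homogeneous of degree two, so it
  vanishes at every scaled torus point and hence on the closure.\<close>

lemma toric_variety_binomial:
  assumes x: "x \<in> toric_variety Q"
    and m: "m1 \<in> lattice_points Q" "m2 \<in> lattice_points Q" "m3 \<in> lattice_points Q" "m4 \<in> lattice_points Q"
    and eq: "m1 + m2 = m3 + m4"
  shows "x m1 * x m2 = x m3 * x m4"
proof -
  let ?p = "monomial_of 1 [m1, m2] + monomial_of (- 1) [m3, m4]"
  have "poly_eval ?p x = 0"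
  proof (rule poly_eval_eq_0_on_zariski_closure)
    show "?p \<in> poly_ring (lattice_points Q)"
      using m by (intro poly_ring_add poly_ring_monomial_of) auto
  next
    fix y
    assume "y \<in> {\<lambda>m. c * monomial_map Q t m |c t. t \<in> torus}"
    then obtain c t where y: "y = (\<lambda>m. c * monomial_map Q t m)" and t: "t \<in> torus"
      by blast
    have "torus_character m1 t * torus_character m2 t = torus_character m3 t * torus_character m4 t"
      using torus_character_add[OF t, of m1 m2] torus_character_add[OF t, of m3 m4] eq by simp
    then show "poly_eval ?p y = 0"
      using m by (simp add: y monomial_map_def)
  qed (use x in \<open>simp add: toric_variety_def\<close>)
  then show ?thesis by simp
qed

text \<open>The assumption on weights is affine independence of \<open>E\<close>: every prescription
  of values on \<open>E\<close>, after scaling by some \<open>k\<close>, comes from an integral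
  affine function. Its linear part \<open>w\<close> is realised by a one-parameter subgroup and its
  constant \<open>e\<close> by the scalar of the cone, which gives the curves for the Kronecker
  substitution.\<close>

lemma indep_toric_variety:
  fixes E :: "(int ^ 'n) set"
  assumes fin: "finite E" and E: "E \<subseteq> lattice_points Q"
    and weights: "\<And>d :: int ^ 'n \<Rightarrow> nat. \<exists>k>0. \<exists>e w. \<forall>m\<in>E.
                    e + (\<Sum>i\<in>UNIV. w $ i * m $ i) = int (k * d m)"
  shows "E \<in> indep_sets (algebraic_matroid (lattice_points Q) (toric_variety Q))"
proof -
  have "p = 0" if p: "p \<in> vanishing_ideal (lattice_points Q) (toric_variety Q)" "p \<in> poly_ring E" for p
  proof (rule poly_eq_0_if_eval_on_curves_eq_0[OF fin p(2)])
    fix d :: "int ^ 'n \<Rightarrow> nat"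
    obtain k e w where "k > 0"
      and k: "\<And>m. m \<in> E \<Longrightarrow> e + (\<Sum>i\<in>UNIV. w $ i * m $ i) = int (k * d m)"
      using weights[of d] by blast
    show "\<exists>k>0. \<forall>s. s \<noteq> 0 \<longrightarrow> (\<exists>x. (\<forall>i\<in>E. x i = s ^ (k * d i)) \<and> poly_eval p x = 0)"
    proof (intro exI conjI allI impI ballI)
      show "k > 0" by fact
    next
      fix s :: complex and m
      assume s: "s \<noteq> 0" and m: "m \<in> E"
      have "s powi e * torus_character m (\<chi> i. s powi (w $ i)) = s powi int (k * d m)"
        using s k[OF m] by (simp add: torus_character_one_parameter power_int_add [symmetric])
      then show "s powi e * monomial_map Q (\<chi> i. s powi (w $ i)) m = s ^ (k * d m)"
        using E m by (auto simp: monomial_map_def simp del: of_nat_mult)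
    next
      fix s :: complex
      assume "s \<noteq> 0"
      then have "(\<chi> i. s powi (w $ i)) \<in> torus"
        by (simp add: torus_def)
      moreover have "{\<lambda>m. c * monomial_map Q t m |c t. t \<in> torus} \<subseteq> toric_variety Q"
        unfolding toric_variety_def
        using scaled_monomial_map_in_affine_space
        by (intro subset_zariski_closure) blast
      ultimately have "(\<lambda>m. s powi e * monomial_map Q (\<chi> i. s powi (w $ i)) m) \<in> toric_variety Q"
        by blast
      then show "poly_eval p (\<lambda>m. s powi e * monomial_map Q (\<chi> i. s powi (w $ i)) m) = 0"
        using p(1) by (simp add: vanishing_ideal_def)
    qed
  qed
  then show ?thesis
    using E by (auto simp: indep_sets_def algebraic_matroid_def vanishing_ideal_def
        poly_ring_def poly_vars_def)
qed

text \<open>For symmetric matrices with rows \<open>(a, b, c)\<close>, \<open>(b, d, e)\<close>,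
  \<open>(c, e, f)\<close> the hypotheses are the vanishing of all minors of size two, and
  \<open>?det\<close> is the determinant of the sum. A sum of two matrices of rank at most one has
  rank at most two.\<close>

lemma det_sum_rank_one_eq_0:
  fixes a b c d e f a' b' c' d' e' f' :: "'a :: comm_ring_1"
  assumes "a * d = b * b" "a * e = b * c" "a * f = c * c" "b * e = c * d" "b * f = c * e" "d * f = e * e"
    and "a' * d' = b' * b'" "a' * e' = b' * c'" "a' * f' = c' * c'"
      "b' * e' = c' * d'" "b' * f' = c' * e'" "d' * f' = e' * e'"
  shows "(a + a') * (d + d') * (f + f') + 2 * (b + b') * (c + c') * (e + e')
       - (a + a') * (e + e') * (e + e') - (d + d') * (c + c') * (c + c')
       - (f + f') * (b + b') * (b + b') = 0"
    (is "?det = 0")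
proof -
  \<comment> \<open>\<open>det (X + Y) = det X + tr (adj X Y) + tr (X adj Y) + det Y\<close>\<close>
  have "?det = (a + a') * (d * f - e * e) + (d' * (a * f - c * c) + f' * (a * d - b * b))
      + (b + 2 * b') * (c * e - b * f) + (c + 2 * c') * (b * e - c * d) + 2 * e' * (b * c - a * e)
      + (a' + a) * (d' * f' - e' * e') + (d * (a' * f' - c' * c') + f * (a' * d' - b' * b'))
      + (b' + 2 * b) * (c' * e' - b' * f') + (c' + 2 * c) * (b' * e' - c' * d') + 2 * e * (b' * c' - a' * e')"
    by (simp add: algebra_simps)
  then show ?thesis
    by (simp only: assms diff_self mult_zero_right add_0_right)
qed

text \<open>The relations place \<open>a\<close>, \<open>d\<close>, \<open>f\<close> at the vertices
  of a triangle and \<open>b\<close>, \<open>c\<close>, \<open>e\<close> at the midpoints of its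
  edges. They turn into the six minors of the symmetric matrix, whose determinant \<open>p\<close>
  is a nonzero polynomial in these coordinates that vanishes on the secant variety.\<close>

lemma veronese_dependent_secant_variety:
  fixes a b c d e f :: "int ^ 'n"
  assumes pts: "{a, b, c, d, e, f} \<subseteq> lattice_points Q"
    and distinct: "distinct [a, b, c, d, e, f]"
    and rel: "a + d = b + b" "a + e = b + c" "a + f = c + c" "b + e = c + d" "b + f = c + e" "d + f = e + e"
  shows "{a, b, c, d, e, f} \<notin> indep_sets (algebraic_matroid (lattice_points Q)
           (secant_variety (lattice_points Q) (toric_variety Q)))"
proof -
  let ?I = "lattice_points Q" and ?E = "{a, b, c, d, e, f}"
  define p where "p = monomial_of 1 [a, d, f] + monomial_of 2 [b, c, e] + monomial_of (- 1) [a, e, e]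
    + monomial_of (- 1) [d, c, c] + monomial_of (- 1) [f, b, b]"
  have eval: "poly_eval p x = x a * x d * x f + 2 * x b * x c * x e
      - x a * x e * x e - x d * x c * x c - x f * x b * x b" for x
    by (simp add: p_def mult.assoc)
  \<comment> \<open>The identity matrix has determinant one, which shows that \<open>p\<close> is
    nonzero; distinctness keeps the off-diagonal coordinates at zero.\<close>
  have "poly_eval p (\<lambda>m. if m \<in> {a, d, f} then 1 else 0) = 1"
    unfolding eval using distinct by auto
  then have "p \<noteq> 0"
    by auto
  have p_ring: "p \<in> poly_ring ?E"
    unfolding p_def by (intro poly_ring_add poly_ring_monomial_of) auto
  then have p_ring': "p \<in> poly_ring ?I"
    using poly_ring_mono[OF pts] by blast
  have sum: "poly_eval p y = 0"
    if y: "y \<in> {\<lambda>i. x1 i + x2 i | x1 x2. x1 \<in> toric_variety Q \<and> x2 \<in> toric_variety Q}" for y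
  proof -
    obtain x1 x2 where y: "y = (\<lambda>i. x1 i + x2 i)"
      and x: "x1 \<in> toric_variety Q" "x2 \<in> toric_variety Q"
      using y by blast
    have minors: "x a * x d = x b * x b" "x a * x e = x b * x c" "x a * x f = x c * x c"
        "x b * x e = x c * x d" "x b * x f = x c * x e" "x d * x f = x e * x e"
      if "x \<in> toric_variety Q" for x
      using pts rel by (auto intro!: toric_variety_binomial[OF that])
    show ?thesis
      unfolding eval y using det_sum_rank_one_eq_0[OF minors[OF x(1)] minors[OF x(2)]] .
  qed
  have "p \<in> vanishing_ideal ?I (secant_variety ?I (toric_variety Q))"
    unfolding vanishing_ideal_def secant_variety_def
    using p_ring' poly_eval_eq_0_on_zariski_closure[OF p_ring' sum] by blast
  with p_ring \<open>p \<noteq> 0\<close> show ?thesis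
    by (auto simp: indep_sets_def algebraic_matroid_def)
qed

section \<open>Lattice affine maps\<close>

lemma lattice_affine_image_lattice_point:
  assumes "lattice_affine_image A b P \<subseteq> Q" "of_lattice p \<in> P"
  shows "A *v p + b \<in> lattice_points Q"
proof -
  have "of_lattice (A *v p + b) = map_matrix real_of_int A *v of_lattice p + of_lattice b"
    by (simp add: of_lattice_def vec_eq_iff matrix_vector_mult_def)
  then show ?thesis
    using assms by (auto simp: lattice_points_def lattice_affine_image_def)
qed

text \<open>Affine functions are transported by the integral inverse \<open>B\<close> of
  \<open>A\<close>: \<open>w'\<close> is the row vector \<open>w\<close> times \<open>B\<close>, and
  the constant absorbs the translation \<open>b\<close>.\<close>

lemma exists_weights_lattice_affine:
  fixes A :: "int ^ 'n ^ 'n" and b w :: "int ^ 'n"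
  assumes "invertible A"
  shows "\<exists>e' w'. \<forall>p. e' + (\<Sum>i\<in>UNIV. w' $ i * (A *v p + b) $ i) = e + (\<Sum>i\<in>UNIV. w $ i * p $ i)"
proof -
  obtain B where B: "B ** A = mat 1"
    using assms by (auto simp: invertible_def)
  define w' where "w' = (\<chi> i. \<Sum>j\<in>UNIV. w $ j * B $ j $ i)"
  have "(\<Sum>i\<in>UNIV. w' $ i * (A *v p) $ i) = (\<Sum>i\<in>UNIV. w $ i * p $ i)" for p
  proof -
    have "(\<Sum>i\<in>UNIV. w' $ i * (A *v p) $ i)
        = (\<Sum>j\<in>UNIV. \<Sum>i\<in>UNIV. w $ j * (B $ j $ i * (A *v p) $ i))"
      unfolding w'_def by (subst sum.swap) (simp add: sum_distrib_right mult.assoc)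
    also have "\<dots> = (\<Sum>j\<in>UNIV. w $ j * (B *v (A *v p)) $ j)"
      by (simp add: matrix_vector_mult_def[of B] sum_distrib_left)
    also have "B *v (A *v p) = p"
      by (simp add: matrix_vector_mul_assoc B)
    finally show ?thesis .
  qed
  then have "(e - (\<Sum>i\<in>UNIV. w' $ i * b $ i)) + (\<Sum>i\<in>UNIV. w' $ i * (A *v p + b) $ i)
      = e + (\<Sum>i\<in>UNIV. w $ i * p $ i)" for p
    by (simp add: distrib_left sum.distrib)
  then show ?thesis by blast
qed

text \<open>This allows the weights to be checked in the original coordinates of \<open>S\<close>:
  prescribed values on the image are pulled back to \<open>S\<close> and the affine function is
  pushed forward.\<close>

lemma indep_toric_variety_lattice_affine:
  fixes A :: "int ^ 'n ^ 'n" and b :: "int ^ 'n"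
  assumes A: "invertible A" and fin: "finite S" and pts: "(\<lambda>p. A *v p + b) ` S \<subseteq> lattice_points Q"
    and weights: "\<And>d :: int ^ 'n \<Rightarrow> nat. \<exists>k>0. \<exists>e w. \<forall>p\<in>S.
                    e + (\<Sum>i\<in>UNIV. w $ i * p $ i) = int (k * d p)"
  shows "(\<lambda>p. A *v p + b) ` S \<in> indep_sets (algebraic_matroid (lattice_points Q) (toric_variety Q))"
proof (rule indep_toric_variety)
  fix d :: "int ^ 'n \<Rightarrow> nat"
  obtain k e w where k: "k > 0"
    "\<And>p. p \<in> S \<Longrightarrow> e + (\<Sum>i\<in>UNIV. w $ i * p $ i) = int (k * d (A *v p + b))"
    using weights[of "\<lambda>p. d (A *v p + b)"] by blast
  obtain e' w' where
    "\<And>p. e' + (\<Sum>i\<in>UNIV. w' $ i * (A *v p + b) $ i) = e + (\<Sum>i\<in>UNIV. w $ i * p $ i)"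
    using exists_weights_lattice_affine[OF A] by blast
  with k show "\<exists>k>0. \<exists>e w. \<forall>m\<in>(\<lambda>p. A *v p + b) ` S.
      e + (\<Sum>i\<in>UNIV. w $ i * m $ i) = int (k * d m)"
    by (intro exI[of _ k] conjI exI[of _ e'] exI[of _ w']) auto
qed (use fin pts in auto)

theorem theorem4p4:
  fixes P Q :: "(real ^ 3) set"
    and A :: "int ^ 3 ^ 3"
    and b :: "int ^ 3"
  assumes P_def: "P = convex hull {vector [0, 0, 1], vector [1, 0, 2], vector [0, 2, 1],
                                   vector [2, 2, 1], vector [1, 1, 0]}"
    and Q: "lattice_polytope Q"
    and A: "invertible A"
    and sub: "lattice_affine_image A b P \<subseteq> Q"
  shows "algebraic_matroid (lattice_points Q) (secant_variety (lattice_points Q) (toric_variety Q))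
       \<noteq> matroid_union (algebraic_matroid (lattice_points Q) (toric_variety Q))
                       (algebraic_matroid (lattice_points Q) (toric_variety Q))"
proof -
  let ?M = "algebraic_matroid (lattice_points Q) (toric_variety Q)"
  define v :: "int \<Rightarrow> int \<Rightarrow> int ^ 3" where "v = (\<lambda>x y. vector [x, y, 1])"
  define h where "h = (\<lambda>p. A *v p + b)"
  have v_nth: "v x y $ 1 = x" "v x y $ 2 = y" "v x y $ 3 = 1" for x y
    by (simp_all add: v_def vector_3)
  obtain B where B: "B ** A = mat 1"
    using A by (auto simp: invertible_def)
  have inj_h: "h p = h q \<longleftrightarrow> p = q" for p q
  proof
    assume "h p = h q"
    then have "B *v (A *v p) = B *v (A *v q)"
      by (simp only: h_def add_right_cancel)
    then show "p = q"
      by (simp only: matrix_vector_mul_assoc B matrix_vector_mul_lid)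
  qed simp
  have v_eq: "v x y = v x' y' \<longleftrightarrow> x = x' \<and> y = y'" for x y x' y'
    by (auto simp: vec_eq_iff forall_3 v_nth)
  have v_add_eq: "v x y + v x' y' = v p q + v p' q' \<longleftrightarrow> x + x' = p + p' \<and> y + y' = q + q'"
    for x y x' y' p q p' q'
    by (auto simp: vec_eq_iff forall_3 v_nth)
  have h_add: "h p + h q = h p' + h q'" if "p + q = p' + q'" for p q p' q'
    using arg_cong[OF that, of "(*v) A"] by (simp add: h_def matrix_vector_right_distrib algebra_simps)
  have of_lattice_v: "of_lattice (v x y) = vector [real_of_int x, real_of_int y, 1]" for x y
    by (simp add: of_lattice_def vec_eq_iff forall_3 vector_3 v_nth)
  have vertices: "vector [0, 0, 1] \<in> P" "vector [0, 2, 1] \<in> P" "vector [2, 2, 1] \<in> P"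
    unfolding P_def by (auto intro!: hull_inc)
  have "convex P"
    by (simp add: P_def)
  have mid: "(1/2) *\<^sub>R x + (1/2) *\<^sub>R y \<in> P" if "x \<in> P" "y \<in> P" for x y
    using convexD[OF \<open>convex P\<close> that, of "1/2" "1/2"] by simp
  \<comment> \<open>The remaining lattice points of the triangle at height one are midpoints of its
    edges, so convexity puts them in \<open>P\<close>.\<close>
  have edges: "vector [0, 1, 1] \<in> P" "vector [1, 1, 1] \<in> P" "vector [1, 2, 1] \<in> P"
  proof -
    have "vector [0, 1, 1] = (1/2) *\<^sub>R vector [0, 0, 1] + (1/2) *\<^sub>R (vector [0, 2, 1] :: real ^ 3)"
      "vector [1, 1, 1] = (1/2) *\<^sub>R vector [0, 0, 1] + (1/2) *\<^sub>R (vector [2, 2, 1] :: real ^ 3)"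
      "vector [1, 2, 1] = (1/2) *\<^sub>R vector [0, 2, 1] + (1/2) *\<^sub>R (vector [2, 2, 1] :: real ^ 3)"
      by (simp_all add: vec_eq_iff forall_3 vector_3)
    with mid vertices show "vector [0, 1, 1] \<in> P" "vector [1, 1, 1] \<in> P" "vector [1, 2, 1] \<in> P"
      by metis+
  qed
  have pts: "h ` {v 0 0, v 0 2, v 2 2} \<subseteq> lattice_points Q" "h ` {v 0 1, v 1 1, v 1 2} \<subseteq> lattice_points Q"
    unfolding h_def
    using lattice_affine_image_lattice_point[OF sub] vertices edges by (auto simp: of_lattice_v)
  have "h ` {v 0 0, v 0 2, v 2 2} \<in> indep_sets ?M"
    using pts(1) unfolding h_def
  proof (intro indep_toric_variety_lattice_affine[OF A])
    fix d :: "int ^ 3 \<Rightarrow> nat"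
    show "\<exists>k>0. \<exists>e w. \<forall>p\<in>{v 0 0, v 0 2, v 2 2}. e + (\<Sum>i\<in>UNIV. w $ i * p $ i) = int (k * d p)"
    proof (intro exI conjI)
      \<comment> \<open>Interpolation of \<open>d\<close> at the vertices. The edges have lattice
        length two, so slopes may be half-integral and \<open>k = 2\<close> clears the
        denominators.\<close>
      show "\<forall>p\<in>{v 0 0, v 0 2, v 2 2}. 2 * int (d (v 0 0)) + (\<Sum>i\<in>UNIV.
          vector [int (d (v 2 2)) - int (d (v 0 2)), int (d (v 0 2)) - int (d (v 0 0)), 0] $ i * p $ i)
          = int (2 * d p)"
        by (simp add: sum_3 vector_3 v_nth)
    qed simp
  qed auto
  moreover have "h ` {v 0 1, v 1 1, v 1 2} \<in> indep_sets ?M"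
    using pts(2) unfolding h_def
  proof (intro indep_toric_variety_lattice_affine[OF A])
    fix d :: "int ^ 3 \<Rightarrow> nat"
    show "\<exists>k>0. \<exists>e w. \<forall>p\<in>{v 0 1, v 1 1, v 1 2}. e + (\<Sum>i\<in>UNIV. w $ i * p $ i) = int (k * d p)"
    proof (intro exI conjI)
      \<comment> \<open>The midpoints form a unimodular triangle, so interpolation is integral and
        \<open>k = 1\<close> suffices.\<close>
      show "\<forall>p\<in>{v 0 1, v 1 1, v 1 2}.
          int (d (v 0 1)) - int (d (v 1 2)) + int (d (v 1 1)) + (\<Sum>i\<in>UNIV.
          vector [int (d (v 1 1)) - int (d (v 0 1)), int (d (v 1 2)) - int (d (v 1 1)), 0] $ i * p $ i)
          = int (1 * d p)"
        by (simp add: sum_3 vector_3 v_nth)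
    qed simp
  qed auto
  ultimately have "h ` {v 0 0, v 0 2, v 2 2} \<union> h ` {v 0 1, v 1 1, v 1 2} \<in> indep_sets (matroid_union ?M ?M)"
    by (auto simp only: matroid_union_def indep_sets_def snd_conv)
  \<comment> \<open>The points are reordered as the upper triangle of the symmetric matrix, row by
    row: first row, then \<open>v 0 2\<close>, \<open>v 1 2\<close>, then
    \<open>v 2 2\<close>.\<close>
  also have "h ` {v 0 0, v 0 2, v 2 2} \<union> h ` {v 0 1, v 1 1, v 1 2}
      = {h (v 0 0), h (v 0 1), h (v 1 1), h (v 0 2), h (v 1 2), h (v 2 2)}"
    by auto
  finally have indep: "\<dots> \<in> indep_sets (matroid_union ?M ?M)" .
  have "{h (v 0 0), h (v 0 1), h (v 1 1), h (v 0 2), h (v 1 2), h (v 2 2)} \<notin>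
      indep_sets (algebraic_matroid (lattice_points Q) (secant_variety (lattice_points Q) (toric_variety Q)))"
    by (rule veronese_dependent_secant_variety; (rule h_add, simp only: v_add_eq)?;
        use pts in \<open>simp add: inj_h v_eq\<close>)
  with indep show ?thesis by metis
qed

end
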